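(* A simple game $G$ on a finite set of players is a disjunctive hierarchical game (for some partition of the players into levels $P_1,\dots,P_m$ and some positive thresholds $k_1<\dots<k_m$) if and only if $G$ is complete and its canonical representation has exactly one shift-maximal losing coalition.
   Context: A simple game on a finite set $P$ is a pair $(P,W)$ with $W$ a nonempty family of subsets of $P$ closed under supersets (winning coalitions). The disjunctive hierarchical game with partition $P=P_1\cup\dots\cup P_m$ and thresholds $k_1<\dots<k_m$ has as winning coalitions those $X$ for which there exists $i$ with $|X\cap(P_1\cup\dots\cup P_i)|\ge k_i$. Isbell's desirability relation: $i\succeq_G j$ iff for every $X\subseteq P$ containing neither $i$ nor $j$, $X\cup\{j\}\in W$ implies $X\cup\{i\}\in W$; $G$ is complete if $\succeq_G$ is a total preorder. Players $i,j$ are equivalent ($i\sim_G j$) if $i\succeq_G j$ and $j\succeq_G i$. If the equivalence classes have sizes $n_1,\dots,n_m$, numbered so that class 1 is strictly more desirable than class 2, etc. (for a complete game), the canonical representation is the game on the multiset $\{1^{n_1},\dots,m^{n_m}\}$ in which the submultiset $\{1^{\ell_1},\dots,m^{\ell_m}\}$ ($0\le\ell_i\le n_i$) is winning iff a coalition with $\ell_i$ players from class $i$ for each $i$ is winning. In this multiset game, a submultiset $A'$ is obtained from $A=\{1^{\ell_1},\dots,m^{\ell_m}\}$ by a shift if for some $i<j$ with $\ell_i\ge1$ and $\ell_j<n_j$, $A'$ has multiplicities $\ell_i-1$ at $i$, $\ell_j+1$ at $j$, and the same as $A$ elsewhere. A losing submultiset $Y$ is shift-maximal if every submultiset strictly containing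 $Y$ is winning and there is no losing submultiset from which $Y$ is obtained by a shift. *)

theory Defs
  imports Main "HOL-Library.Multiset" "HOL-Library.Disjoint_Sets"
begin

definition simple_game :: "'a set \<Rightarrow> 'a set set \<Rightarrow> bool" where
  "simple_game P W \<longleftrightarrow>
     finite P \<and> W \<subseteq> Pow P \<and> W \<noteq> {} \<and>
     (\<forall>X Y. X \<in> W \<and> X \<subseteq> Y \<and> Y \<subseteq> P \<longrightarrow> Y \<in> W)"

definition hierarchy :: "'a set \<Rightarrow> nat \<Rightarrow> (nat \<Rightarrow> 'a set) \<Rightarrow> (nat \<Rightarrow> nat) \<Rightarrow> bool" where
  "hierarchy P m L k \<longleftrightarrow>
     1 \<le> m \<and> (\<Union>i\<in>{1..m}. L i) = P \<and> disjoint_family_on L {1..m} \<and> (\<forall>i\<in>{1..m}. L i \<noteq> {}) \<and>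
     (\<forall>i\<in>{1..m}. 0 < k i) \<and> strict_mono_on {1..m} k"

definition disjunctive_winning ::
    "'a set \<Rightarrow> nat \<Rightarrow> (nat \<Rightarrow> 'a set) \<Rightarrow> (nat \<Rightarrow> nat) \<Rightarrow> 'a set set" where
  "disjunctive_winning P m L k =
     {X. X \<subseteq> P \<and> (\<exists>i\<in>{1..m}. k i \<le> card (X \<inter> (\<Union>j\<in>{1..i}. L j)))}"

definition disjunctive_hierarchical :: "'a set \<Rightarrow> 'a set set \<Rightarrow> bool" where
  "disjunctive_hierarchical P W \<longleftrightarrow>
     (\<exists>m L k. hierarchy P m L k \<and> W = disjunctive_winning P m L k)"

text \<open>A pair \<open>(i, j)\<close> in the desirability relation means that \<open>i\<close> is at least as desirable
  as \<open>j\<close>.\<close>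

definition desirability :: "'a set \<Rightarrow> 'a set set \<Rightarrow> 'a rel" where
  "desirability P W =
     {(i, j). i \<in> P \<and> j \<in> P \<and>
        (\<forall>X. X \<subseteq> P \<and> i \<notin> X \<and> j \<notin> X \<and> insert j X \<in> W \<longrightarrow> insert i X \<in> W)}"

definition complete_game :: "'a set \<Rightarrow> 'a set set \<Rightarrow> bool" where
  "complete_game P W \<longleftrightarrow> preorder_on P (desirability P W) \<and> total_on P (desirability P W)"

definition equivalence :: "'a set \<Rightarrow> 'a set set \<Rightarrow> 'a rel" where
  "equivalence P W = desirability P W \<inter> (desirability P W)\<inverse>"

text \<open>\<open>C 1, \<dots>, C m\<close> lists the equivalence classes in strictly decreasing order of
  desirability. For a complete game such a numbering exists, and \<open>m\<close> and the values of \<open>C\<close> on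
  \<open>{1..m}\<close> are uniquely determined.\<close>

definition class_numbering :: "'a set \<Rightarrow> 'a set set \<Rightarrow> nat \<Rightarrow> (nat \<Rightarrow> 'a set) \<Rightarrow> bool" where
  "class_numbering P W m C \<longleftrightarrow>
     bij_betw C {1..m} (P // equivalence P W) \<and>
     (\<forall>i\<in>{1..m}. \<forall>j\<in>{1..m}. i < j \<longrightarrow>
        (\<forall>p\<in>C i. \<forall>q\<in>C j. (p, q) \<in> desirability P W \<and> (q, p) \<notin> desirability P W))"

definition class_mset :: "nat \<Rightarrow> (nat \<Rightarrow> 'a set) \<Rightarrow> nat multiset" where
  "class_mset m C = (\<Sum>i\<in>{1..m}. replicate_mset (card (C i)) i)"

definition canonical_winning :: "'a set set \<Rightarrow> nat \<Rightarrow> (nat \<Rightarrow> 'a set) \<Rightarrow> nat multiset set" where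
  "canonical_winning W m C =
     {A. A \<subseteq># class_mset m C \<and> (\<exists>X\<in>W. \<forall>i\<in>{1..m}. card (X \<inter> C i) = count A i)}"

text \<open>The following two notions refer to an arbitrary game on the submultisets of \<open>N\<close>, with
  winning submultisets \<open>V\<close>.\<close>

definition shift :: "nat multiset \<Rightarrow> nat multiset \<Rightarrow> nat multiset \<Rightarrow> bool" where
  "shift N A A' \<longleftrightarrow>
     (\<exists>i j. i < j \<and> 1 \<le> count A i \<and> count A j < count N j \<and> A' = add_mset j (A - {#i#}))"

definition shift_maximal_losing ::
    "nat multiset \<Rightarrow> nat multiset set \<Rightarrow> nat multiset \<Rightarrow> bool" where
  "shift_maximal_losing N V Y \<longleftrightarrow>
     Y \<subseteq># N \<and> Y \<notin> V \<and>
     (\<forall>A. A \<subseteq># N \<and> Y \<subset># A \<longrightarrow> A \<in> V) \<and>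
     \<not> (\<exists>A. A \<subseteq># N \<and> A \<notin> V \<and> shift N A Y)"

end

theory Submission
  imports Defs "HOL-Library.Infinite_Set"
begin

text \<open>
  Number the desirability classes from best to worst and compare submultisets through their prefix
  sums, the numbers of members in classes \<open>1, \<dots>, i\<close>. In a complete game winning is monotone in this
  dominance order, and the shift-maximal losing submultisets are exactly the maximal losing ones.
  If there is only one, \<open>Y\<close>, then the losing submultisets are those dominated by \<open>Y\<close>, so the classes
  together with the thresholds \<open>1 + prefix sum of Y\<close> present the game as a hierarchy: two equal
  thresholds would make the members of two different classes equally desirable. Conversely, the
  non-redundant thresholds of a hierarchical game bound prefix sums of losing submultisets, and such
  bounds are preserved by pointwise maxima of prefix sums, whence two maximal losing submultisets
  coincide.
\<close>

section \<open>Dominance of multisets\<close>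

definition prefix_size :: "nat multiset \<Rightarrow> nat \<Rightarrow> nat" where
  "prefix_size A i = size (filter_mset (\<lambda>j. j \<le> i) A)"

text \<open>Total sizes need not agree: for large \<open>i\<close> the inequality compares them. The
  order thus contains inclusion, and a shifted multiset lies below the original.\<close>

definition dominated :: "nat multiset \<Rightarrow> nat multiset \<Rightarrow> bool" where
  "dominated A B \<longleftrightarrow> (\<forall>i. prefix_size A i \<le> prefix_size B i)"

lemma prefix_size_add_mset:
  "prefix_size (add_mset x A) i = prefix_size A i + (if x \<le> i then 1 else 0)"
  by (simp add: prefix_size_def)

lemma prefix_size_0: "prefix_size A 0 = count A 0"
  by (induction A) (auto simp: prefix_size_def)

lemma prefix_size_Suc: "prefix_size A (Suc i) = prefix_size A i + count A (Suc i)"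
  by (induction A) (auto simp: prefix_size_def le_Suc_eq)

lemma prefix_size_mono: "A \<subseteq># B \<Longrightarrow> prefix_size A i \<le> prefix_size B i"
  by (simp add: prefix_size_def multiset_filter_mono size_mset_mono)

lemma prefix_size_index_mono: "i \<le> j \<Longrightarrow> prefix_size A i \<le> prefix_size A j"
  by (rule lift_Suc_mono_le) (simp_all add: prefix_size_Suc)

lemma prefix_size_inject:
  assumes "\<And>i. prefix_size A i = prefix_size B i"
  shows "A = B"
proof (rule multiset_eqI)
  fix i show "count A i = count B i"
    using assms[of i] assms[of "i - 1"]
    by (cases i) (auto simp: prefix_size_0 prefix_size_Suc)
qed

lemma dominated_refl: "dominated A A"
  by (simp add: dominated_def)

lemma dominated_trans: "dominated A B \<Longrightarrow> dominated B C \<Longrightarrow> dominated A C"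
  unfolding dominated_def using le_trans by blast

lemma subseteq_dominated: "A \<subseteq># B \<Longrightarrow> dominated A B"
  by (simp add: dominated_def prefix_size_mono)

lemma prefix_size_shifted:
  assumes "i < j" "i \<in># A"
  shows "prefix_size (add_mset j (A - {#i#})) l + (if i \<le> l \<and> l < j then 1 else 0) = prefix_size A l"
proof -
  obtain B where "A = add_mset i B" using assms(2) by (meson mset_add)
  then show ?thesis using assms(1) by (auto simp: prefix_size_add_mset)
qed

lemma shift_dominated:
  assumes "shift N A A'"
  shows "dominated A' A" "A' \<noteq> A"
proof -
  obtain i j where ij: "i < j" "i \<in># A" "A' = add_mset j (A - {#i#})"
    using assms unfolding shift_def by (metis count_greater_eq_one_iff)
  have p: "prefix_size A' l + (if i \<le> l \<and> l < j then 1 else 0) = prefix_size A l" for l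
    using prefix_size_shifted[OF ij(1,2)] ij(3) by simp
  show "dominated A' A" unfolding dominated_def using p by (metis le_add1)
  show "A' \<noteq> A" using p[of i] ij(1) by auto
qed

text \<open>One move up from \<open>A\<close> that stays below \<open>B\<close>. At the first index
  \<open>i\<close> where \<open>A\<close> falls behind, a copy of \<open>i\<close> is added; if the
  gap closes again at a later \<open>j\<close>, a copy of \<open>j\<close> is removed, so that no
  prefix sum from \<open>j\<close> on changes.\<close>

lemma dominated_step:
  assumes AN: "A \<subseteq># N" and BN: "B \<subseteq># N" and dom: "dominated A B" and ne: "A \<noteq> B"
  obtains A' where "A' \<subseteq># N" "dominated A' B" "A \<subset># A' \<or> shift N A' A"
proof -
  have le: "prefix_size A i \<le> prefix_size B i" for i
    using dom by (simp add: dominated_def)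
  have "\<exists>i. prefix_size A i < prefix_size B i"
    using ne le prefix_size_inject by (metis le_neq_implies_less)
  then obtain i where i: "prefix_size A i < prefix_size B i"
    and imin: "\<And>l. l < i \<Longrightarrow> \<not> prefix_size A l < prefix_size B l"
    using exists_least_iff[of "\<lambda>i. prefix_size A i < prefix_size B i"] by blast
  \<comment> \<open>The prefix sums agree before \<open>i\<close>, so the gap at \<open>i\<close>
    comes from the multiplicity of \<open>i\<close> itself. This leaves room in \<open>N\<close> for
    one more copy.\<close>
  have "count A i < count B i"
    using i imin[of "i - 1"] le[of "i - 1"]
    by (cases i) (auto simp: prefix_size_0 prefix_size_Suc)
  then have ci: "count A i < count N i"
    using BN by (meson less_le_trans mset_subset_eq_count)
  have addN: "add_mset i A \<subseteq># N"
    using ci AN by (auto simp: subseteq_mset_def Suc_le_eq)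
  show thesis
  proof (cases "\<exists>j>i. prefix_size A j = prefix_size B j")
    case False
    then have lt: "prefix_size A l < prefix_size B l" if "l \<ge> i" for l
      using i le that by (metis le_neq_implies_less)
    have "dominated (add_mset i A) B"
      unfolding dominated_def prefix_size_add_mset using lt le by (auto simp: Suc_le_eq)
    then show thesis using that[OF addN] by simp
  next
    case True
    define j where "j = (LEAST j. i < j \<and> prefix_size A j = prefix_size B j)"
    have "i < j \<and> prefix_size A j = prefix_size B j"
      unfolding j_def using True by (rule LeastI_ex)
    then have j: "i < j" "prefix_size A j = prefix_size B j" by blast+
    have jmin: "\<not> (i < l \<and> prefix_size A l = prefix_size B l)" if "l < j" for l
      using that not_less_Least unfolding j_def by blast
    have lt: "prefix_size A l < prefix_size B l" if "i \<le> l" "l < j" for l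
      using that i jmin[of l] le[of l] by (metis le_neq_implies_less)
    obtain j' where j': "j = Suc j'" using j(1) by (cases j) auto
    \<comment> \<open>The gap is open at \<open>j - 1\<close> and closed at \<open>j\<close>, so
      \<open>A\<close> has more copies of \<open>j\<close> than \<open>B\<close>, hence at least
      one.\<close>
    have "j \<in># A"
      using lt[of j'] j j' by (auto simp: prefix_size_Suc simp flip: count_greater_zero_iff)
    then obtain A0 where A0: "A = add_mset j A0" by (meson mset_add)
    define A' where "A' = add_mset i A0"
    have A'N: "A' \<subseteq># N"
      using addN unfolding A'_def A0 by (metis add_mset_commute mset_subset_eq_insertD subset_mset.less_imp_le)
    have "count A' j < count N j"
      using AN j(1) unfolding A'_def A0 subseteq_mset_def by (auto simp: Suc_le_eq dest: spec[of _ j])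
    then have "shift N A' A"
      unfolding shift_def by (intro exI[of _ i] exI[of _ j]) (simp add: j(1) A'_def A0)
    moreover have "dominated A' B"
      unfolding dominated_def
    proof
      fix l show "prefix_size A' l \<le> prefix_size B l"
        using le[of l] lt[of l] j(1) unfolding A'_def A0 prefix_size_add_mset
        by (auto split: if_splits)
    qed
    ultimately show thesis using that[OF A'N] by simp
  qed
qed

text \<open>An increment of the pointwise maximum is at most the larger of the two corresponding
  increments, so the multiset with these increments still fits into \<open>N\<close>.\<close>

lemma ex_mset_max_prefix_size:
  assumes AN: "A \<subseteq># N" and BN: "B \<subseteq># N"
  obtains M where "M \<subseteq># N" "\<And>i. prefix_size M i = max (prefix_size A i) (prefix_size B i)"
proof -
  define f where "f i = max (prefix_size A i) (prefix_size B i)" for i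
  define g where "g i = (if i = 0 then f 0 else f i - f (i - 1))" for i
  have cA: "count A i \<le> count N i" and cB: "count B i \<le> count N i" for i
    using AN BN by (auto simp: mset_subset_eq_count)
  have g_le: "g i \<le> count N i" for i
    using cA[of i] cB[of i]
    by (cases i) (auto simp: g_def f_def prefix_size_0 prefix_size_Suc)
  \<comment> \<open>Summing over the elements of \<open>N\<close> loses nothing, since
    \<open>g i\<close> vanishes outside \<open>N\<close> by \<open>g_le\<close>.\<close>
  define M where "M = (\<Sum>i\<in>set_mset N. replicate_mset (g i) i)"
  have cM: "count M i = g i" for i
    using g_le[of i] by (auto simp: M_def count_sum if_distrib not_in_iff cong: if_cong)
  have "prefix_size M i = f i" for i
  proof (induction i)
    case 0
    then show ?case by (simp add: prefix_size_0 cM g_def)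
  next
    case (Suc i)
    have "f i \<le> f (Suc i)" by (auto simp: f_def prefix_size_Suc)
    then show ?case using Suc by (simp add: prefix_size_Suc cM g_def)
  qed
  moreover have "M \<subseteq># N" using g_le cM by (simp add: subseteq_mset_def)
  ultimately show thesis using that by (simp add: f_def)
qed

text \<open>If a losing \<open>A\<close> lies properly above \<open>Y\<close>,
  \<open>dominated_step\<close> gives a multiset below \<open>A\<close>, hence losing by
  \<open>mono\<close>, that properly contains \<open>Y\<close> or shifts to \<open>Y\<close>.
  Conversely, enlarging and undoing a shift both go properly upwards in dominance.\<close>

lemma shift_maximal_losing_iff:
  assumes mono: "\<And>A B. A \<in> V \<Longrightarrow> B \<subseteq># N \<Longrightarrow> dominated A B \<Longrightarrow> B \<in> V"
  shows "shift_maximal_losing N V Y \<longleftrightarrow>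
    Y \<subseteq># N \<and> Y \<notin> V \<and> (\<forall>A. A \<subseteq># N \<longrightarrow> A \<notin> V \<longrightarrow> dominated Y A \<longrightarrow> A = Y)"
    (is "_ \<longleftrightarrow> ?R")
proof
  assume Y: "shift_maximal_losing N V Y"
  have "A = Y" if A: "A \<subseteq># N" "A \<notin> V" "dominated Y A" for A
  proof (rule ccontr)
    assume "A \<noteq> Y"
    moreover have "Y \<subseteq># N" using Y by (simp add: shift_maximal_losing_def)
    ultimately obtain Y' where Y': "Y' \<subseteq># N" "dominated Y' A" "Y \<subset># Y' \<or> shift N Y' Y"
      using dominated_step A by metis
    then have "Y' \<notin> V" using mono A by blast
    then show False using Y Y' unfolding shift_maximal_losing_def by blast
  qed
  then show ?R using Y unfolding shift_maximal_losing_def by blast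
next
  assume ?R
  then show "shift_maximal_losing N V Y"
    unfolding shift_maximal_losing_def
    using subseteq_dominated shift_dominated by (metis subset_mset.less_le)
qed

text \<open>The sum of the prefix sums strictly increases along proper dominance and is bounded on
  submultisets of \<open>N\<close>; a losing multiset above \<open>A\<close> that maximizes it is
  maximal.\<close>

lemma ex_shift_maximal_losing:
  assumes mono: "\<And>A B. A \<in> V \<Longrightarrow> B \<subseteq># N \<Longrightarrow> dominated A B \<Longrightarrow> B \<in> V"
    and A: "A \<subseteq># N" "A \<notin> V"
  obtains Y where "shift_maximal_losing N V Y" "dominated A Y"
proof -
  \<comment> \<open>All elements of \<open>N\<close> lie below \<open>n\<close>, so the prefix sums
    below \<open>n\<close> distinguish submultisets of \<open>N\<close>, and the weight is a finite
    sum.\<close>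
  obtain n where n: "\<forall>x\<in>#N. x < n"
    using finite_nat_set_iff_bounded finite_set_mset by blast
  let ?Q = "\<lambda>B. B \<subseteq># N \<and> B \<notin> V \<and> dominated A B"
  let ?w = "\<lambda>B. \<Sum>i<n. prefix_size B i"
  have "?Q A" using A dominated_refl by blast
  moreover have "\<forall>B. ?Q B \<longrightarrow> ?w B < Suc (?w N)"
    by (auto intro!: sum_mono prefix_size_mono simp: less_Suc_eq_le)
  ultimately have "\<exists>Y. ?Q Y \<and> (\<forall>B. ?Q B \<longrightarrow> ?w B \<le> ?w Y)"
    by (rule ex_has_greatest_nat)
  then obtain Y where Y: "?Q Y" and Ymax: "\<And>B. ?Q B \<Longrightarrow> ?w B \<le> ?w Y" by metis
  have "B = Y" if B: "B \<subseteq># N" "B \<notin> V" "dominated Y B" for B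
  proof (rule ccontr)
    assume "B \<noteq> Y"
    then obtain i where "prefix_size Y i \<noteq> prefix_size B i"
      using prefix_size_inject by blast
    have ex: "\<exists>i<n. prefix_size Y i \<noteq> prefix_size B i"
    proof (rule ccontr)
      assume eq: "\<not> ?thesis"
      have "count Y i = count B i" for i
      proof (cases "i < n")
        case True
        then have "prefix_size Y i = prefix_size B i" "prefix_size Y (i - 1) = prefix_size B (i - 1)"
          using eq less_imp_diff_less by blast+
        then show ?thesis by (cases i) (auto simp: prefix_size_0 prefix_size_Suc)
      next
        case False
        then have "i \<notin># N" using n by blast
        then have "i \<notin># Y" "i \<notin># B" using Y B(1) by (auto dest: mset_subset_eqD)
        then show ?thesis by (simp add: not_in_iff)
      qed
      then show False using \<open>B \<noteq> Y\<close> by (metis multiset_eqI)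
    qed
    have "?w Y < ?w B"
    proof (rule sum_strict_mono_ex1)
      show "\<forall>i\<in>{..<n}. prefix_size Y i \<le> prefix_size B i"
        using B(3) by (simp add: dominated_def)
      then show "\<exists>i\<in>{..<n}. prefix_size Y i < prefix_size B i"
        using ex by (metis le_neq_implies_less lessThan_iff)
    qed simp
    moreover have "?Q B" using B Y dominated_trans by blast
    ultimately show False using Ymax[of B] by linarith
  qed
  then have "shift_maximal_losing N V Y"
    using Y by (simp add: shift_maximal_losing_iff[OF mono])
  then show thesis using that Y by blast
qed

section \<open>Games ranked by desirability\<close>

text \<open>Smaller rank means more desirable. The rank abstracts a class numbering: players of
  equal rank form a class, and gaps between the ranks are permitted.\<close>

locale ranked_game =
  fixes P :: "'a set" and W :: "'a set set" and r :: "'a \<Rightarrow> nat"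
  assumes game: "simple_game P W"
    and rank: "\<And>p q. p \<in> P \<Longrightarrow> q \<in> P \<Longrightarrow> (p, q) \<in> desirability P W \<longleftrightarrow> r p \<le> r q"
begin

text \<open>The submultiset of the canonical representation determined by a coalition, when ranks
  are class numbers.\<close>

definition profile :: "'a set \<Rightarrow> nat multiset" where
  "profile X = image_mset r (mset_set X)"

lemma finite_coalition: "X \<subseteq> P \<Longrightarrow> finite X"
  using game finite_subset unfolding simple_game_def by blast

lemma winning_subset: "X \<in> W \<Longrightarrow> X \<subseteq> P"
  using game unfolding simple_game_def by blast

lemma winning_superset: "X \<in> W \<Longrightarrow> X \<subseteq> Y \<Longrightarrow> Y \<subseteq> P \<Longrightarrow> Y \<in> W"
  using game unfolding simple_game_def by blast

lemma count_profile: "finite X \<Longrightarrow> count (profile X) i = card {x \<in> X. r x = i}"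
  unfolding profile_def count_image_mset'
  by (simp add: count_mset_set' sum.If_cases Collect_conj_eq) (metis Collect_mem_eq Int_commute)

lemma profile_insert:
  "finite X \<Longrightarrow> x \<notin> X \<Longrightarrow> profile (insert x X) = add_mset (r x) (profile X)"
  by (simp add: profile_def)

lemma profile_mono: "X \<subseteq> Y \<Longrightarrow> finite Y \<Longrightarrow> profile X \<subseteq># profile Y"
  unfolding profile_def by (intro image_mset_subseteq_mono subset_imp_msubset_mset_set)

lemma prefix_size_profile:
  assumes "finite X"
  shows "prefix_size (profile X) i = card {x \<in> X. r x \<le> i}"
proof -
  have "prefix_size (profile X) i = size (image_mset r (filter_mset (\<lambda>x. r x \<le> i) (mset_set X)))"
    by (simp add: prefix_size_def profile_def filter_mset_image_mset)
  then show ?thesis using assms by simp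
qed

text \<open>Lets statements about submultisets be proved on coalitions. As long as the multiplicity
  of \<open>a\<close> is below the number of players of that rank, a further such player is
  free.\<close>

lemma profile_realize:
  assumes "A \<subseteq># profile P"
  obtains X where "X \<subseteq> P" "profile X = A"
proof -
  have "A \<subseteq># profile P \<Longrightarrow> \<exists>X\<subseteq>P. profile X = A" for A
  proof (induction A)
    case empty
    then show ?case by (intro exI[of _ "{}"]) (simp add: profile_def)
  next
    case (add a A)
    then obtain X where X: "X \<subseteq> P" "profile X = A"
      by (meson mset_subset_eq_insertD subset_mset.less_imp_le)
    have "count A a < count (profile P) a"
      using mset_subset_eq_count[OF add.prems, of a] X(2) by simp
    then have "card {x \<in> X. r x = a} < card {x \<in> P. r x = a}"
      using X finite_coalition count_profile by (metis subset_refl)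
    then have "\<not> {x \<in> P. r x = a} \<subseteq> {x \<in> X. r x = a}"
      using finite_coalition[OF X(1)] by (metis (no_types, lifting) card_mono finite_Collect_conjI not_le
          finite_subset mem_Collect_eq subsetI)
    then obtain p where "p \<in> P" "p \<notin> X" "r p = a" by blast
    then show ?case using X profile_insert finite_coalition
      by (intro exI[of _ "insert p X"]) auto
  qed
  then show thesis using that assms by blast
qed

lemma swap_winning:
  assumes "insert q X \<in> W" "p \<in> P" "p \<notin> X" "r p \<le> r q"
  shows "insert p X \<in> W"
proof (cases "q \<in> X")
  case True
  then show ?thesis using assms winning_superset winning_subset
    by (metis insert_absorb insert_subset subset_insertI)
next
  case False
  have "insert q X \<subseteq> P" using assms(1) winning_subset by blast
  then have "(p, q) \<in> desirability P W" using assms rank by blast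
  then show ?thesis using assms False \<open>insert q X \<subseteq> P\<close> unfolding desirability_def by blast
qed

text \<open>Swapping a best-ranked member of \<open>X - Y\<close> for a member of \<open>Y - X\<close> that is at least as good
  preserves the dominance, because \<open>X\<close> has no member outside \<open>Y\<close> of strictly better rank.\<close>

lemma winning_dominated:
  assumes "X \<in> W" "Y \<subseteq> P" "dominated (profile X) (profile Y)"
  shows "Y \<in> W"
  using assms
proof (induction "card (X - Y)" arbitrary: X rule: less_induct)
  case less
  note X = less.prems(1) and Y = less.prems(2) and dom = less.prems(3)
  have fX: "finite X" and fY: "finite Y"
    using X Y winning_subset finite_coalition by blast+
  have le: "card {x \<in> X. r x \<le> i} \<le> card {x \<in> Y. r x \<le> i}" for i
    using dom fX fY by (simp add: dominated_def prefix_size_profile)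
  show ?case
  proof (cases "X \<subseteq> Y")
    case True
    then show ?thesis using X Y winning_superset by blast
  next
    case False
    then obtain x where x: "x \<in> X - Y" and xmin: "\<And>z. z \<in> X - Y \<Longrightarrow> r x \<le> r z"
      using ex_has_least_nat[of "\<lambda>z. z \<in> X - Y" _ r] by blast
    \<comment> \<open>Otherwise \<open>X\<close> would contain all members of \<open>Y\<close> up to
      rank \<open>r x\<close> and also \<open>x\<close>, which is outside \<open>Y\<close>,
      contradicting dominance at \<open>r x\<close>.\<close>
    have "\<not> {z \<in> Y. r z \<le> r x} \<subseteq> {z \<in> X. r z \<le> r x}"
    proof
      assume "{z \<in> Y. r z \<le> r x} \<subseteq> {z \<in> X. r z \<le> r x}"
      then have "{z \<in> Y. r z \<le> r x} \<subset> {z \<in> X. r z \<le> r x}" using x by blast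
      then have "card {z \<in> Y. r z \<le> r x} < card {z \<in> X. r z \<le> r x}"
        using fX by (intro psubset_card_mono) auto
      then show False using le[of "r x"] by simp
    qed
    then obtain y where y: "y \<in> Y" "y \<notin> X" "r y \<le> r x" by blast
    define Z where "Z = X - {x}"
    have XZ: "X = insert x Z" "x \<notin> Z" "y \<notin> Z" "finite Z" using x y fX by (auto simp: Z_def)
    have win: "insert y Z \<in> W"
      using swap_winning[of x Z y] X XZ y Y by blast
    have "insert y Z - Y \<subset> X - Y" using x y XZ by auto
    then have card: "card (insert y Z - Y) < card (X - Y)"
      using fX by (simp add: psubset_card_mono)
    have "dominated (profile (insert y Z)) (profile Y)"
      unfolding dominated_def
    proof
      fix i
      have pX: "prefix_size (profile X) i = prefix_size (profile Z) i + (if r x \<le> i then 1 else 0)"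
        using XZ by (simp add: profile_insert prefix_size_add_mset)
      have pZ: "prefix_size (profile (insert y Z)) i
          = prefix_size (profile Z) i + (if r y \<le> i then 1 else 0)"
        using XZ by (simp add: profile_insert prefix_size_add_mset)
      have XY: "prefix_size (profile X) i \<le> prefix_size (profile Y) i"
        using dom by (simp add: dominated_def)
      show "prefix_size (profile (insert y Z)) i \<le> prefix_size (profile Y) i"
      \<comment> \<open>Only in this range does the swap raise the prefix sum. There all members of
        \<open>X\<close> of rank at most \<open>i\<close> lie in \<open>Y\<close> by the choice of
        \<open>x\<close>, and \<open>y\<close> is an extra one, so the unit increase is
        absorbed.\<close>
      proof (cases "r y \<le> i \<and> i < r x")
        case True
        have "{z \<in> X. r z \<le> i} \<subset> {z \<in> Y. r z \<le> i}"
          using xmin True y by fastforce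
        then have "prefix_size (profile X) i < prefix_size (profile Y) i"
          using fX fY by (simp add: prefix_size_profile psubset_card_mono)
        then show ?thesis using pX pZ True by simp
      next
        case False
        then show ?thesis using pX pZ XY y(3) by (auto split: if_splits)
      qed
    qed
    then show ?thesis using less.hyps[OF card win Y] by blast
  qed
qed

text \<open>Coalitions with equal profiles dominate each other, so winning depends on the profile
  alone.\<close>

lemma winning_iff_profile: "X \<subseteq> P \<Longrightarrow> X \<in> W \<longleftrightarrow> profile X \<in> profile ` W"
  using winning_dominated dominated_refl by (auto simp: image_iff)

lemma profile_winning_mono:
  assumes "A \<in> profile ` W" "B \<subseteq># profile P" "dominated A B"
  shows "B \<in> profile ` W"
proof -
  obtain X where "X \<in> W" "A = profile X" using assms(1) by blast
  moreover obtain Y where "Y \<subseteq> P" "profile Y = B" using profile_realize assms(2) by blast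
  ultimately show ?thesis using winning_dominated assms(3) by blast
qed

lemma shift_maximal_losing_profile_iff:
  "shift_maximal_losing (profile P) (profile ` W) Y \<longleftrightarrow>
    Y \<subseteq># profile P \<and> Y \<notin> profile ` W \<and>
    (\<forall>A. A \<subseteq># profile P \<longrightarrow> A \<notin> profile ` W \<longrightarrow> dominated Y A \<longrightarrow> A = Y)"
  by (rule shift_maximal_losing_iff) (rule profile_winning_mono)

lemma ex_shift_maximal_losing_profile:
  assumes "A \<subseteq># profile P" "A \<notin> profile ` W"
  obtains Y where "shift_maximal_losing (profile P) (profile ` W) Y" "dominated A Y"
  using profile_winning_mono assms that by (rule ex_shift_maximal_losing)

text \<open>Bounds on prefix sums pass to pointwise maxima, so two shift-maximal losing multisets
  lie below a common losing one and both equal it. Positive bounds make the empty multiset losing,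
  which yields existence.\<close>

lemma losing_prefix_bounds_unique:
  assumes pos: "\<And>a. a \<in> I \<Longrightarrow> 0 < k a"
    and win: "\<And>X. X \<subseteq> P \<Longrightarrow> X \<in> W \<longleftrightarrow> (\<exists>a\<in>I. k a \<le> card {x \<in> X. r x \<le> c a})"
  shows "\<exists>!Y. shift_maximal_losing (profile P) (profile ` W) Y"
proof -
  have win': "A \<in> profile ` W \<longleftrightarrow> (\<exists>a\<in>I. k a \<le> prefix_size A (c a))"
    if sub: "A \<subseteq># profile P" for A
  proof -
    obtain X where X: "X \<subseteq> P" "A = profile X" using profile_realize[OF sub] by metis
    have "A \<in> profile ` W \<longleftrightarrow> X \<in> W" unfolding X(2) by (rule winning_iff_profile[OF X(1), symmetric])
    also have "\<dots> \<longleftrightarrow> (\<exists>a\<in>I. k a \<le> prefix_size A (c a))"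
      unfolding X(2) prefix_size_profile[OF finite_coalition[OF X(1)]] by (rule win[OF X(1)])
    finally show ?thesis .
  qed
  have "prefix_size {#} i = 0" for i by (simp add: prefix_size_def)
  then have "{#} \<notin> profile ` W" using win'[of "{#}"] pos by fastforce
  then obtain Y where Y: "shift_maximal_losing (profile P) (profile ` W) Y"
    using ex_shift_maximal_losing_profile[of "{#}"] by (metis empty_le)
  have "Y = Z" if Z: "shift_maximal_losing (profile P) (profile ` W) Z" for Z
  proof -
    note Y' = Y[unfolded shift_maximal_losing_profile_iff]
      and Z' = Z[unfolded shift_maximal_losing_profile_iff]
    obtain M where M: "M \<subseteq># profile P"
      "\<And>i. prefix_size M i = max (prefix_size Y i) (prefix_size Z i)"
      using ex_mset_max_prefix_size Y' Z' by metis
    have "M \<notin> profile ` W"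
      using win'[OF M(1)] win'[of Y] win'[of Z] Y' Z' M(2) by (auto simp: le_max_iff_disj)
    moreover have "dominated Y M" "dominated Z M" using M(2) by (auto simp: dominated_def)
    ultimately show ?thesis using Y' Z' M(1) by metis
  qed
  then show ?thesis using Y by blast
qed

text \<open>Every losing multiset lies below some shift-maximal losing one, which can only be
  \<open>Y\<close>; everything below \<open>Y\<close> loses by monotonicity. Losing thus means being
  dominated by \<open>Y\<close>.\<close>

lemma unique_losing_prefix_bounds:
  assumes Y: "shift_maximal_losing (profile P) (profile ` W) Y"
    and uniq: "\<And>Z. shift_maximal_losing (profile P) (profile ` W) Z \<Longrightarrow> Z = Y"
    and X: "X \<subseteq> P"
  shows "X \<in> W \<longleftrightarrow> (\<exists>i. prefix_size Y i < card {x \<in> X. r x \<le> i})"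
proof -
  have sub: "profile X \<subseteq># profile P"
    using X profile_mono finite_coalition by blast
  have "profile X \<notin> profile ` W \<longleftrightarrow> dominated (profile X) Y"
  proof
    assume "profile X \<notin> profile ` W"
    then obtain Z where "shift_maximal_losing (profile P) (profile ` W) Z" "dominated (profile X) Z"
      using ex_shift_maximal_losing_profile[OF sub] by blast
    then show "dominated (profile X) Y" using uniq by blast
  next
    assume "dominated (profile X) Y"
    then show "profile X \<notin> profile ` W"
      using profile_winning_mono Y unfolding shift_maximal_losing_def by blast
  qed
  then show ?thesis
    unfolding winning_iff_profile[OF X] dominated_def prefix_size_profile[OF finite_coalition[OF X]]
    by (meson not_le)
qed

end

section \<open>Transitivity of desirability and the numbering of its classes\<close>

lemma desirability_trans:
  assumes "simple_game P W"
  shows "trans (desirability P W)"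
proof (rule transI)
  fix x y z
  assume xy: "(x, y) \<in> desirability P W" and yz: "(y, z) \<in> desirability P W"
  have P: "x \<in> P" "y \<in> P" "z \<in> P" using xy yz by (auto simp: desirability_def)
  have xyD: "insert x X \<in> W" if "X \<subseteq> P" "x \<notin> X" "y \<notin> X" "insert y X \<in> W" for X
    using xy that by (auto simp: desirability_def)
  have yzD: "insert y X \<in> W" if "X \<subseteq> P" "y \<notin> X" "z \<notin> X" "insert z X \<in> W" for X
    using yz that by (auto simp: desirability_def)
  have "insert x X \<in> W" if X: "X \<subseteq> P" "x \<notin> X" "z \<notin> X" "insert z X \<in> W" for X
  proof (cases "x = z \<or> x = y \<or> y = z \<or> y \<notin> X")
    case True
    then show ?thesis using X xyD yzD by metis
  next
    case False
    \<comment> \<open>With \<open>y\<close> taken out of \<open>X\<close>, two exchanges suffice: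
      \<open>X0\<close> with \<open>y\<close> and \<open>z\<close> becomes \<open>X0\<close> with
      \<open>x\<close> and \<open>z\<close>, then \<open>X0\<close> with \<open>x\<close> and
      \<open>y\<close>, which is \<open>insert x X\<close>.\<close>
    define X0 where "X0 = X - {y}"
    have X0: "X = insert y X0" "y \<notin> X0" using False by (auto simp: X0_def)
    have "insert y (insert z X0) \<in> W" using X X0 by (simp add: insert_commute)
    then have "insert x (insert z X0) \<in> W" using False X X0 P by (intro xyD) auto
    then have "insert z (insert x X0) \<in> W" by (simp add: insert_commute)
    then have "insert y (insert x X0) \<in> W" using False X X0 P by (intro yzD) auto
    then show ?thesis using X0 by (simp add: insert_commute)
  qed
  then show "(x, z) \<in> desirability P W" using P by (simp add: desirability_def)
qed

lemma equiv_equivalence: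
  assumes "complete_game P W"
  shows "equiv P (equivalence P W)"
proof -
  have "preorder_on P (desirability P W)" using assms by (simp add: complete_game_def)
  then show ?thesis
    unfolding preorder_on_def equivalence_def equiv_def
    by (auto simp: refl_on_def sym_def intro: trans_Int)
qed

text \<open>The index of a player's class serves as its rank, which carries the results on ranked
  games over to any class numbering.\<close>

lemma class_numbering_rank:
  assumes game: "simple_game P W" and comp: "complete_game P W" and num: "class_numbering P W m C"
  shows "\<exists>r. ranked_game P W r \<and> (\<forall>p\<in>P. r p \<in> {1..m}) \<and>
    (\<forall>i\<in>{1..m}. C i = {p \<in> P. r p = i})"
proof -
  note eqv = equiv_equivalence[OF comp]
  have img: "C ` {1..m} = P // equivalence P W"
    using num by (simp add: class_numbering_def bij_betw_def)
  have strict: "(p, q) \<in> desirability P W" "(q, p) \<notin> desirability P W"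
    if "i \<in> {1..m}" "j \<in> {1..m}" "i < j" "p \<in> C i" "q \<in> C j" for i j p q
    using num that unfolding class_numbering_def by blast+
  have un: "(\<Union>i\<in>{1..m}. C i) = P" using Union_quotient[OF eqv] img by simp
  then have "\<forall>p\<in>P. \<exists>i. i \<in> {1..m} \<and> p \<in> C i" by blast
  then obtain r where r: "\<And>p. p \<in> P \<Longrightarrow> r p \<in> {1..m}" "\<And>p. p \<in> P \<Longrightarrow> p \<in> C (r p)"
    by metis
  \<comment> \<open>A player in two differently numbered classes would be strictly more desirable
    than itself.\<close>
  have disj: "i = j" if "i \<in> {1..m}" "j \<in> {1..m}" "p \<in> C i" "p \<in> C j" for i j p
    using strict[of i j p p] strict[of j i p p] that by (meson linorder_neqE_nat)
  have C: "C i = {p \<in> P. r p = i}" if "i \<in> {1..m}" for i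
    using that un r disj by blast
  have "ranked_game P W r"
  proof
    fix p q assume pq: "p \<in> P" "q \<in> P"
    consider "r p < r q" | "r q < r p" | "r p = r q" by linarith
    then show "(p, q) \<in> desirability P W \<longleftrightarrow> r p \<le> r q"
    proof cases
      case 3
      have "C (r p) \<in> P // equivalence P W" using img r(1) pq by blast
      then have "(p, q) \<in> equivalence P W"
        using quotient_eq_iff[OF eqv, of "C (r p)" "C (r p)" p q] r(2) pq 3 by metis
      then show ?thesis using 3 by (simp add: equivalence_def)
    qed (use strict r pq in \<open>meson not_le less_imp_le\<close>)+
  qed (fact game)
  then show ?thesis using r(1) C by blast
qed

text \<open>In a total preorder, the number of players at least as desirable as \<open>p\<close> is
  a rank whose fibres are the classes. Listing its values increasingly numbers the classes from the
  best on.\<close>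

lemma ex_class_numbering:
  assumes game: "simple_game P W" and comp: "complete_game P W"
  obtains m C where "class_numbering P W m C"
proof -
  let ?D = "desirability P W"
  have fin: "finite P" using game by (simp add: simple_game_def)
  have D: "?D \<subseteq> P \<times> P" "trans ?D"
    using comp by (auto simp: complete_game_def preorder_on_def)
  have tot: "(p, q) \<in> ?D \<or> (q, p) \<in> ?D" if "p \<in> P" "q \<in> P" for p q
    using comp that unfolding complete_game_def preorder_on_def total_on_def refl_on_def by metis
  define s where "s p = card {q. (q, p) \<in> ?D}" for p
  have fins: "finite {q. (q, p) \<in> ?D}" for p
    using fin D(1) by (auto intro: finite_subset[of _ P])
  have s_le: "s p \<le> s q" if "(p, q) \<in> ?D" for p q
    unfolding s_def using that D(2) by (intro card_mono fins) (auto dest: transD)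
  have s_less: "s p < s q" if "(p, q) \<in> ?D" "(q, p) \<notin> ?D" for p q
  proof -
    have "q \<in> P" using that D by blast
    then have "{x. (x, p) \<in> ?D} \<subset> {x. (x, q) \<in> ?D}"
      using that D(2) tot[of q q] by (auto dest: transD)
    then show ?thesis unfolding s_def by (intro psubset_card_mono fins)
  qed
  have s_iff: "(p, q) \<in> ?D \<longleftrightarrow> s p \<le> s q" if "p \<in> P" "q \<in> P" for p q
    using s_le s_less[of q p] tot that by (meson not_le)
  have fs: "finite (s ` P)" using fin by blast
  define m where "m = card (s ` P)"
  obtain h where h: "bij_betw h {..<m} (s ` P)" "strict_mono_on {..<m} h"
    using ex_bij_betw_strict_mono_card[OF fs] unfolding m_def by blast
  \<comment> \<open>\<open>h\<close> enumerates from 0, whereas classes are numbered from 1.\<close>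
  define C where "C i = {p \<in> P. s p = h (i - 1)}" for i
  have cls: "equivalence P W `` {p} = {q \<in> P. s q = s p}" if "p \<in> P" for p
  proof (intro set_eqI)
    fix q
    have "(p, q) \<in> equivalence P W \<longleftrightarrow> q \<in> P \<and> (p, q) \<in> ?D \<and> (q, p) \<in> ?D"
      using D(1) by (auto simp: equivalence_def)
    then show "q \<in> equivalence P W `` {p} \<longleftrightarrow> q \<in> {q \<in> P. s q = s p}"
      using s_iff that by auto
  qed
  have "bij_betw (\<lambda>i. i - 1) {1..m} {..<m}"
    by (rule bij_betw_byWitness[of _ Suc]) auto
  then have "bij_betw (h \<circ> (\<lambda>i. i - 1)) {1..m} (s ` P)"
    using h(1) by (rule bij_betw_trans)
  moreover have "bij_betw (\<lambda>v. {p \<in> P. s p = v}) (s ` P) (P // equivalence P W)"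
    unfolding bij_betw_def
  proof
    show "inj_on (\<lambda>v. {p \<in> P. s p = v}) (s ` P)"
      by (rule inj_onI) blast
    show "(\<lambda>v. {p \<in> P. s p = v}) ` (s ` P) = P // equivalence P W"
      unfolding quotient_def using cls by (auto simp: image_iff)
  qed
  ultimately have "bij_betw ((\<lambda>v. {p \<in> P. s p = v}) \<circ> (h \<circ> (\<lambda>i. i - 1))) {1..m} (P // equivalence P W)"
    by (rule bij_betw_trans)
  then have "bij_betw C {1..m} (P // equivalence P W)"
    by (simp add: C_def comp_def cong: bij_betw_cong)
  moreover have "(p, q) \<in> ?D \<and> (q, p) \<notin> ?D"
    if "i \<in> {1..m}" "j \<in> {1..m}" "i < j" "p \<in> C i" "q \<in> C j" for i j p q
  proof -
    have "h (i - 1) < h (j - 1)"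
      using that h(2) by (intro strict_mono_onD[OF h(2)]) auto
    then show ?thesis using that s_iff by (auto simp: C_def)
  qed
  ultimately have "class_numbering P W m C" unfolding class_numbering_def by blast
  then show thesis using that by blast
qed

section \<open>The canonical representation as the game of profiles\<close>

context ranked_game
begin

lemma class_mset_eq_profile:
  assumes r: "\<And>p. p \<in> P \<Longrightarrow> r p \<in> {1..m}" and C: "\<And>i. i \<in> {1..m} \<Longrightarrow> C i = {p \<in> P. r p = i}"
  shows "class_mset m C = profile P"
proof (rule multiset_eqI)
  fix i
  have "count (class_mset m C) i = (if i \<in> {1..m} then card (C i) else 0)"
    by (simp add: class_mset_def count_sum if_distrib cong: if_cong)
  also have "\<dots> = card {p \<in> P. r p = i}"
  proof (cases "i \<in> {1..m}")
    case False
    then have "{p \<in> P. r p = i} = {}" using r by blast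
    then show ?thesis using False by (metis card.empty)
  qed (simp add: C)
  also have "\<dots> = count (profile P) i" by (simp add: count_profile finite_coalition)
  finally show "count (class_mset m C) i = count (profile P) i" .
qed

lemma canonical_winning_eq_profile:
  assumes r: "\<And>p. p \<in> P \<Longrightarrow> r p \<in> {1..m}" and C: "\<And>i. i \<in> {1..m} \<Longrightarrow> C i = {p \<in> P. r p = i}"
  shows "canonical_winning W m C = profile ` W"
proof -
  have cnt: "card (X \<inter> C i) = count (profile X) i" if "X \<in> W" "i \<in> {1..m}" for X i
  proof -
    have "X \<inter> C i = {x \<in> X. r x = i}" using C that winning_subset by blast
    then show ?thesis using that winning_subset finite_coalition count_profile by metis
  qed
  have sub: "profile X \<subseteq># profile P" if "X \<in> W" for X
    using that winning_subset finite_coalition profile_mono by blast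
  \<comment> \<open>\<open>canonical_winning\<close> compares multiplicities only on
    \<open>{1..m}\<close>; elsewhere they vanish, because no player has such a rank.\<close>
  have out: "count A i = 0" if "A \<subseteq># profile P" "i \<notin> {1..m}" for A i
  proof -
    have "{p \<in> P. r p = i} = {}" using that(2) r by blast
    then have "count (profile P) i = 0" using count_profile[OF finite_coalition[OF subset_refl]]
      by (metis card.empty)
    then show ?thesis using mset_subset_eq_count[OF that(1), of i] by simp
  qed
  have "A = profile X" if "A \<subseteq># profile P" "X \<in> W" "\<forall>i\<in>{1..m}. card (X \<inter> C i) = count A i" for A X
  proof (rule multiset_eqI)
    fix i show "count A i = count (profile X) i"
      using out[of A i] out[of "profile X" i] sub that cnt by metis
  qed
  moreover have "class_mset m C = profile P"
    using r C by (rule class_mset_eq_profile)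
  ultimately show ?thesis
    using sub cnt by (auto simp: canonical_winning_def)
qed

end

section \<open>Disjunctive hierarchical games\<close>

text \<open>Every initial union of levels that contains \<open>q\<close> also contains
  \<open>p\<close>, so replacing \<open>q\<close> by \<open>p\<close> lowers none of the counts
  compared with the thresholds.\<close>

lemma hierarchy_desirability:
  assumes hier: "hierarchy P m L k" and W: "W = disjunctive_winning P m L k" and fin: "finite P"
    and ab: "a \<in> {1..m}" "b \<in> {1..m}" "a \<le> b" and pq: "p \<in> L a" "q \<in> L b"
  shows "(p, q) \<in> desirability P W"
proof -
  let ?U = "\<lambda>i. \<Union>j\<in>{1..i}. L j"
  have P: "p \<in> P" "q \<in> P" using hier ab pq by (auto simp: hierarchy_def)
  have U: "p \<in> ?U i" if "q \<in> ?U i" "i \<in> {1..m}" for i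
  proof -
    obtain j where j: "j \<in> {1..i}" "q \<in> L j" using \<open>q \<in> ?U i\<close> by blast
    have "j \<in> {1..m}" using j that(2) by auto
    moreover have "disjoint_family_on L {1..m}" using hier by (simp add: hierarchy_def)
    ultimately have "j = b" using ab(2) pq(2) j(2) unfolding disjoint_family_on_def by blast
    then show ?thesis using j ab pq by auto
  qed
  have "insert p X \<in> W" if X: "X \<subseteq> P" "p \<notin> X" "q \<notin> X" "insert q X \<in> W" for X
  proof -
    obtain i where i: "i \<in> {1..m}" "k i \<le> card (insert q X \<inter> ?U i)"
      using X(4) unfolding W disjunctive_winning_def by blast
    have fX: "finite X" using X(1) fin finite_subset by blast
    have "card (insert q X \<inter> ?U i) \<le> card (insert p X \<inter> ?U i)"
    proof (cases "q \<in> ?U i")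
      case True
      have "insert q X \<inter> ?U i = insert q (X \<inter> ?U i)" "insert p X \<inter> ?U i = insert p (X \<inter> ?U i)"
        using True U[OF True i(1)] by blast+
      then show ?thesis using X fX by simp
    next
      case False
      then have "insert q X \<inter> ?U i \<subseteq> insert p X \<inter> ?U i" by blast
      then show ?thesis using fX by (intro card_mono) auto
    qed
    then show ?thesis using i X(1) P unfolding W disjunctive_winning_def
      by (auto intro!: bexI[of _ i])
  qed
  then show ?thesis using P by (simp add: desirability_def)
qed

lemma hierarchy_complete:
  assumes hier: "hierarchy P m L k" and W: "W = disjunctive_winning P m L k"
    and game: "simple_game P W"
  shows "complete_game P W"
proof -
  have fin: "finite P" using game by (simp add: simple_game_def)
  have "(p, q) \<in> desirability P W \<or> (q, p) \<in> desirability P W" if "p \<in> P" "q \<in> P" for p q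
  proof -
    have "(\<Union>i\<in>{1..m}. L i) = P" using hier by (simp add: hierarchy_def)
    then have "\<exists>a\<in>{1..m}. p \<in> L a" "\<exists>b\<in>{1..m}. q \<in> L b" using that by blast+
    then obtain a b where "a \<in> {1..m}" "p \<in> L a" "b \<in> {1..m}" "q \<in> L b" by blast
    then show ?thesis using hierarchy_desirability[OF hier W fin] by (meson le_cases)
  qed
  then show ?thesis
    unfolding complete_game_def preorder_on_def total_on_def refl_on_def
    using desirability_trans[OF game] by (auto simp: desirability_def)
qed

text \<open>A threshold that no coalition reaches without reaching an earlier one is redundant. Up to a
  threshold that is not redundant, the levels exhaust an initial segment of the desirability
  ranking.\<close>

lemma (in ranked_game) hierarchy_levels_ranked:
  assumes hier: "hierarchy P m L k" and W: "W = disjunctive_winning P m L k"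
    and a: "a \<in> {1..m}"
    and X: "X \<subseteq> P" "k a \<le> card (X \<inter> (\<Union>j\<in>{1..a}. L j))"
      "\<And>b. b \<in> {1..<a} \<Longrightarrow> card (X \<inter> (\<Union>j\<in>{1..b}. L j)) < k b"
    and p: "p \<in> (\<Union>j\<in>{1..a}. L j)" and q: "q \<in> P" "q \<notin> (\<Union>j\<in>{1..a}. L j)"
  shows "r p < r q"
proof (rule ccontr)
  assume "\<not> r p < r q"
  let ?U = "\<lambda>i. \<Union>j\<in>{1..i}. L j"
  have fin: "finite P" using finite_coalition by blast
  have UP: "?U i \<subseteq> P" if "i \<in> {1..m}" for i
    using hier that by (fastforce simp: hierarchy_def)
  have kless: "k i < k j" if "i \<in> {1..m}" "j \<in> {1..m}" "i < j" for i j
    using hier that strict_mono_onD unfolding hierarchy_def by metis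
  \<comment> \<open>The coalition is cut down to exactly \<open>k a\<close> members, all in the
    first \<open>a\<close> levels. After one of them is exchanged for \<open>q\<close>, only
    \<open>k a - 1\<close> remain there, while the total is still \<open>k a\<close>.\<close>
  obtain X2 where X2: "X2 \<subseteq> X \<inter> ?U a" "card X2 = k a" "finite X2"
    using obtain_subset_with_card_n[OF X(2)] by metis
  have X2b: "card (X2 \<inter> ?U b) < k b" if "b \<in> {1..<a}" for b
  proof -
    have "card (X2 \<inter> ?U b) \<le> card (X \<inter> ?U b)"
      using X2(1) finite_coalition[OF X(1)] by (intro card_mono) auto
    then show ?thesis using X(3)[OF that] by simp
  qed
  \<comment> \<open>Otherwise all \<open>k a\<close> members lie in the first \<open>a - 1\<close>
    levels and exceed the smaller threshold \<open>k (a - 1)\<close>, which \<open>X\<close> does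
    not reach. For \<open>a = 1\<close> the set would be empty although \<open>k 1\<close> is
    positive.\<close>
  have "\<exists>x\<in>X2. x \<in> L a"
  proof (rule ccontr)
    assume no: "\<not> ?thesis"
    have sub: "X2 \<subseteq> ?U (a - 1)"
    proof
      fix x assume x: "x \<in> X2"
      then obtain j where "j \<in> {1..a}" "x \<in> L j" using X2(1) by blast
      moreover have "j \<noteq> a" using no x calculation by blast
      ultimately show "x \<in> ?U (a - 1)" by (intro UN_I[of j]) auto
    qed
    show False
    proof (cases "a = 1")
      case True
      then have "X2 = {}" using sub by auto
      moreover have "0 < k a" using hier a unfolding hierarchy_def by blast
      ultimately show ?thesis using X2(2) by simp
    next
      case False
      then have "a - 1 \<in> {1..<a}" "a - 1 \<in> {1..m}" using a by auto
      then have "card X2 < k (a - 1)" "k (a - 1) < k a"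
        using X2b[of "a - 1"] sub kless[of "a - 1" a] a by (auto simp: Int_absorb2)
      then show ?thesis using X2(2) by simp
    qed
  qed
  then obtain x where x: "x \<in> X2" "x \<in> L a" by blast
  obtain i where i: "i \<in> {1..a}" "p \<in> L i" using p by blast
  have pP: "p \<in> P" and xP: "x \<in> P" using p x X2(1) UP[OF a] by blast+
  have "(p, x) \<in> desirability P W"
    using hierarchy_desirability[OF hier W fin, of i a p x] i x a by auto
  \<comment> \<open>By assumption \<open>r q\<close> is at most \<open>r p\<close>, and
    \<open>p\<close> is at least as desirable as \<open>x\<close> because its level is not
    later.\<close>
  then have "r q \<le> r x" using rank pP xP \<open>\<not> r p < r q\<close> by auto
  define Z where "Z = X2 - {x}"
  have Z: "X2 = insert x Z" "x \<notin> Z" "finite Z" using x X2(3) by (auto simp: Z_def)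
  have "q \<notin> X2" using q X2(1) by blast
  have "X2 \<in> W"
    using X2 a X(1) unfolding W disjunctive_winning_def
    by (auto intro!: bexI[of _ a] simp: Int_absorb2)
  then have "insert q Z \<in> W"
    using swap_winning[of x Z q] Z \<open>q \<notin> X2\<close> q(1) \<open>r q \<le> r x\<close> by auto
  then obtain b where b: "b \<in> {1..m}" "k b \<le> card (insert q Z \<inter> ?U b)"
    unfolding W disjunctive_winning_def by blast
  have cardZ: "Suc (card Z) = k a" using Z X2(2) by simp
  \<comment> \<open>The exchanged coalition reaches no threshold: before \<open>a\<close>,
    \<open>q\<close> is not counted and \<open>X2\<close> was too small; at \<open>a\<close>, one
    member is missing; after \<open>a\<close>, the total \<open>k a\<close> is below
    \<open>k b\<close>.\<close>
  consider "b < a" | "b = a" | "a < b" by linarith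
  then show False
  proof cases
    case 1
    then have "q \<notin> ?U b" using q(2) by auto
    then have "card (insert q Z \<inter> ?U b) \<le> card (X2 \<inter> ?U b)"
      using X2(3) Z by (intro card_mono) auto
    then show ?thesis using X2b[of b] b 1 by auto
  next
    case 2
    then have "card (insert q Z \<inter> ?U b) \<le> card Z"
      using q(2) Z(3) by (intro card_mono) auto
    then show ?thesis using b cardZ 2 by simp
  next
    case 3
    have "card (insert q Z \<inter> ?U b) \<le> card (insert q Z)"
      using Z(3) by (intro card_mono) auto
    also have "\<dots> \<le> k a" using cardZ Z(3) by (simp add: card_insert_if)
    finally show ?thesis using b kless[OF a b(1) 3] by simp
  qed
qed

text \<open>For the non-redundant thresholds, collected in \<open>I\<close>, the union of the first
  \<open>a\<close> levels is the initial segment of the ranking up to \<open>c a\<close>, the worst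
  rank occurring in it. The thresholds thus become bounds on prefix sums, and
  \<open>losing_prefix_bounds_unique\<close> applies.\<close>

lemma (in ranked_game) hierarchy_unique_shift_maximal:
  assumes hier: "hierarchy P m L k" and W: "W = disjunctive_winning P m L k"
  shows "\<exists>!Y. shift_maximal_losing (profile P) (profile ` W) Y"
proof -
  let ?U = "\<lambda>i. \<Union>j\<in>{1..i}. L j"
  define I where "I = {a \<in> {1..m}. \<exists>X\<subseteq>P. k a \<le> card (X \<inter> ?U a) \<and> (\<forall>b\<in>{1..<a}. card (X \<inter> ?U b) < k b)}"
  define c where "c a = Max (r ` ?U a)" for a
  have UP: "?U a \<subseteq> P" "?U a \<noteq> {}" if "a \<in> {1..m}" for a
    using hier that by (fastforce simp: hierarchy_def)+
  have seg: "X \<inter> ?U a = {x \<in> X. r x \<le> c a}" if aI: "a \<in> I" and X: "X \<subseteq> P" for a X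
  proof -
    have a: "a \<in> {1..m}" using aI by (simp add: I_def)
    have fU: "finite (r ` ?U a)" using UP(1)[OF a] finite_coalition by blast
    have "c a \<in> r ` ?U a" unfolding c_def using fU UP(2)[OF a] by (intro Max_in) auto
    then obtain p where p: "p \<in> ?U a" "r p = c a" by force
    obtain X' where X': "X' \<subseteq> P" "k a \<le> card (X' \<inter> ?U a)"
      "\<And>b. b \<in> {1..<a} \<Longrightarrow> card (X' \<inter> ?U b) < k b"
      using aI unfolding I_def by blast
    have "x \<in> ?U a \<longleftrightarrow> r x \<le> c a" if "x \<in> X" for x
    proof
      assume "x \<in> ?U a"
      then show "r x \<le> c a" unfolding c_def using fU by (intro Max_ge imageI)
    next
      assume le: "r x \<le> c a"
      show "x \<in> ?U a"
      proof (rule ccontr)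
        assume "x \<notin> ?U a"
        then have "r p < r x"
          using hierarchy_levels_ranked[OF hier W a X' p(1)] that X by blast
        then show False using p(2) le by simp
      qed
    qed
    then show ?thesis by blast
  qed
  show ?thesis
  proof (rule losing_prefix_bounds_unique)
    show "0 < k a" if "a \<in> I" for a
      using hier that by (simp add: hierarchy_def I_def)
  next
    fix X assume X: "X \<subseteq> P"
    have "X \<in> W \<longleftrightarrow> (\<exists>a\<in>I. k a \<le> card (X \<inter> ?U a))"
    proof
      assume "X \<in> W"
      then have ex: "\<exists>a. a \<in> {1..m} \<and> k a \<le> card (X \<inter> ?U a)"
        unfolding W disjunctive_winning_def by blast
      \<comment> \<open>The least threshold reached by \<open>X\<close> is non-redundant, with
        \<open>X\<close> itself as witness, so restricting to \<open>I\<close> does not change which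
        coalitions win.\<close>
      define a where "a = (LEAST a. a \<in> {1..m} \<and> k a \<le> card (X \<inter> ?U a))"
      have a: "a \<in> {1..m} \<and> k a \<le> card (X \<inter> ?U a)"
        unfolding a_def using ex by (rule LeastI_ex)
      have "card (X \<inter> ?U b) < k b" if "b \<in> {1..<a}" for b
      proof -
        have "b \<in> {1..m}" "b < a" using a that by auto
        then show ?thesis using not_less_Least[OF \<open>b < a\<close>[unfolded a_def]] by simp
      qed
      then have "a \<in> I" unfolding I_def using a X by blast
      then show "\<exists>a\<in>I. k a \<le> card (X \<inter> ?U a)" using a by blast
    next
      assume "\<exists>a\<in>I. k a \<le> card (X \<inter> ?U a)"
      then show "X \<in> W" using X unfolding W disjunctive_winning_def I_def by blast
    qed
    then show "X \<in> W \<longleftrightarrow> (\<exists>a\<in>I. k a \<le> card {x \<in> X. r x \<le> c a})"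
      by (simp only: seg[OF _ X] cong: bex_cong)
  qed
qed

section \<open>From prefix bounds to a hierarchy with the desirability classes as levels\<close>

lemma (in ranked_game) disjunctive_hierarchical_of_prefix_bounds:
  assumes r: "\<And>p. p \<in> P \<Longrightarrow> r p \<in> {1..m}"
    and C: "\<And>i. i \<in> {1..m} \<Longrightarrow> C i = {p \<in> P. r p = i}"
    and ne: "\<And>i. i \<in> {1..m} \<Longrightarrow> C i \<noteq> {}"
    and win: "\<And>X. X \<subseteq> P \<Longrightarrow> X \<in> W \<longleftrightarrow> (\<exists>i. prefix_size Y i < card {x \<in> X. r x \<le> i})"
  shows "disjunctive_hierarchical P W"
proof -
  \<comment> \<open>The successor turns strictly exceeding the bound into reaching a threshold, and
    makes the thresholds positive.\<close>
  define k where "k i = Suc (prefix_size Y i)" for i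
  have "P \<in> W" using game unfolding simple_game_def by blast
  then have "P \<noteq> {}" using win[of P] by auto
  then have m: "1 \<le> m" using r by fastforce
  have U: "X \<inter> (\<Union>j\<in>{1..i}. C j) = {x \<in> X. r x \<le> i}" if "X \<subseteq> P" "i \<in> {1..m}" for X i
    using that r C by auto
  have win': "X \<in> W \<longleftrightarrow> (\<exists>i\<in>{1..m}. k i \<le> card {x \<in> X. r x \<le> i})" if X: "X \<subseteq> P" for X
  proof
    assume "X \<in> W"
    then obtain i where i: "prefix_size Y i < card {x \<in> X. r x \<le> i}" using win X by blast
    then have "{x \<in> X. r x \<le> i} \<noteq> {}" by force
    then have "1 \<le> i" using r X by fastforce
    show "\<exists>i\<in>{1..m}. k i \<le> card {x \<in> X. r x \<le> i}"
    proof (cases "i \<le> m")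
      case True
      then show ?thesis using i \<open>1 \<le> i\<close> by (auto simp: k_def Suc_le_eq)
    next
      case False
      \<comment> \<open>Beyond \<open>m\<close> the counts no longer grow whereas the bound does not
        decrease, so index \<open>m\<close> already serves.\<close>
      then have "{x \<in> X. r x \<le> i} = {x \<in> X. r x \<le> m}" using r X by fastforce
      then have "k m \<le> card {x \<in> X. r x \<le> m}"
        using i prefix_size_index_mono[of m i Y] False by (simp add: k_def)
      then show ?thesis using m by auto
    qed
  next
    assume "\<exists>i\<in>{1..m}. k i \<le> card {x \<in> X. r x \<le> i}"
    then show "X \<in> W" using win[OF X] by (auto simp: k_def Suc_le_eq)
  qed
  have "X \<in> W \<longleftrightarrow> X \<in> disjunctive_winning P m C k" for X
    using win'[of X] U[of X] winning_subset[of X] unfolding disjunctive_winning_def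
    by (cases "X \<subseteq> P") auto
  then have "W = disjunctive_winning P m C k" by blast
  moreover have "hierarchy P m C k"
    unfolding hierarchy_def
  proof (intro conjI)
    show "(\<Union>i\<in>{1..m}. C i) = P" using C r by auto
    show "disjoint_family_on C {1..m}" unfolding disjoint_family_on_def using C by auto
    show "strict_mono_on {1..m} k"
    \<comment> \<open>\<open>k\<close> is weakly increasing, so a failure makes it constant from
      \<open>i\<close> to \<open>j\<close>. Then exchanging \<open>p\<close> of class
      \<open>i\<close> for \<open>q\<close> of the worse class \<open>j\<close> keeps a winning
      coalition winning, against the strict ranking.\<close>
    proof (rule strict_mono_onI, rule ccontr)
      fix i j assume ij: "i \<in> {1..m}" "j \<in> {1..m}" "i < j" "\<not> k i < k j"
      obtain p where p: "p \<in> P" "r p = i" using ne[OF ij(1)] C[OF ij(1)] by blast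
      obtain q where q: "q \<in> P" "r q = j" using ne[OF ij(2)] C[OF ij(2)] by blast
      have "insert q X \<in> W" if X: "X \<subseteq> P" "q \<notin> X" "p \<notin> X" "insert p X \<in> W" for X
      proof -
        have fX: "finite X" using X finite_coalition by blast
        have card: "card {x \<in> insert y X. r x \<le> l} = card {x \<in> X. r x \<le> l} + (if r y \<le> l then 1 else 0)"
          if "y \<notin> X" for y l
        proof -
          have "{x \<in> insert y X. r x \<le> l} = (if r y \<le> l then insert y {x \<in> X. r x \<le> l} else {x \<in> X. r x \<le> l})"
            by auto
          then show ?thesis using fX that by simp
        qed
        obtain l where l: "prefix_size Y l < card {x \<in> insert p X. r x \<le> l}"
          using X(1,4) p(1) win[of "insert p X"] by auto
        have "\<exists>l. prefix_size Y l < card {x \<in> insert q X. r x \<le> l}"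
        proof (cases "i \<le> l \<and> l < j")
          \<comment> \<open>At \<open>l\<close> only \<open>p\<close> is counted, not
            \<open>q\<close>. The index \<open>j\<close> takes over: its bound is no larger, and
            \<open>q\<close> is counted there.\<close>
          case True
          have "prefix_size Y j \<le> prefix_size Y l"
            using ij(4) prefix_size_index_mono[of i l Y] True by (simp add: k_def)
          moreover have "card {x \<in> X. r x \<le> l} \<le> card {x \<in> X. r x \<le> j}"
            using fX True by (intro card_mono) auto
          ultimately have "prefix_size Y j < card {x \<in> insert q X. r x \<le> j}"
            using l card X p q True by simp
          then show ?thesis by blast
        next
          case False
          then have "prefix_size Y l < card {x \<in> insert q X. r x \<le> l}"
            using l card X p q ij(3) by (auto split: if_splits)
          then show ?thesis by blast
        qed
        then show ?thesis using win[of "insert q X"] X(1) q(1) by auto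
      qed
      then have "(q, p) \<in> desirability P W" using p q by (simp add: desirability_def)
      then show False using rank p q ij(3) by simp
    qed
  qed (use m ne in \<open>auto simp: k_def\<close>)
  ultimately show ?thesis unfolding disjunctive_hierarchical_def by blast
qed

theorem theorem6:
  fixes P :: "'a set" and W :: "'a set set"
  assumes "simple_game P W"
  shows "disjunctive_hierarchical P W \<longleftrightarrow>
    complete_game P W \<and>
    (\<exists>m C. class_numbering P W m C \<and>
       (\<exists>!Y. shift_maximal_losing (class_mset m C) (canonical_winning W m C) Y))"
proof
  assume "disjunctive_hierarchical P W"
  then obtain m L k where hier: "hierarchy P m L k" and W: "W = disjunctive_winning P m L k"
    unfolding disjunctive_hierarchical_def by blast
  have comp: "complete_game P W" using hierarchy_complete[OF hier W assms] .
  obtain m' C where num: "class_numbering P W m' C"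
    using ex_class_numbering[OF assms comp] .
  obtain r where rg: "ranked_game P W r" and r: "\<And>p. p \<in> P \<Longrightarrow> r p \<in> {1..m'}"
    and C: "\<And>i. i \<in> {1..m'} \<Longrightarrow> C i = {p \<in> P. r p = i}"
    using class_numbering_rank[OF assms comp num] by blast
  interpret ranked_game P W r by (fact rg)
  have "class_mset m' C = profile P" using r C by (rule class_mset_eq_profile)
  moreover have "canonical_winning W m' C = profile ` W" using r C by (rule canonical_winning_eq_profile)
  ultimately show "complete_game P W \<and> (\<exists>m C. class_numbering P W m C \<and>
       (\<exists>!Y. shift_maximal_losing (class_mset m C) (canonical_winning W m C) Y))"
    using comp num hierarchy_unique_shift_maximal[OF hier W] by metis
next
  assume "complete_game P W \<and> (\<exists>m C. class_numbering P W m C \<and>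
       (\<exists>!Y. shift_maximal_losing (class_mset m C) (canonical_winning W m C) Y))"
  then obtain m C where comp: "complete_game P W" and num: "class_numbering P W m C"
    and ex1: "\<exists>!Y. shift_maximal_losing (class_mset m C) (canonical_winning W m C) Y"
    by blast
  obtain r where rg: "ranked_game P W r" and r: "\<And>p. p \<in> P \<Longrightarrow> r p \<in> {1..m}"
    and C: "\<And>i. i \<in> {1..m} \<Longrightarrow> C i = {p \<in> P. r p = i}"
    using class_numbering_rank[OF assms comp num] by blast
  interpret ranked_game P W r by (fact rg)
  have "class_mset m C = profile P" using r C by (rule class_mset_eq_profile)
  moreover have "canonical_winning W m C = profile ` W" using r C by (rule canonical_winning_eq_profile)
  ultimately have ex1': "\<exists>!Y. shift_maximal_losing (profile P) (profile ` W) Y"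
    using ex1 by simp
  then obtain Y where Y: "shift_maximal_losing (profile P) (profile ` W) Y" by blast
  have uniq: "Z = Y" if "shift_maximal_losing (profile P) (profile ` W) Z" for Z
    using ex1' Y that by blast
  \<comment> \<open>Levels of a hierarchy must be nonempty, which holds for equivalence
    classes.\<close>
  have "C i \<noteq> {}" if "i \<in> {1..m}" for i
  proof -
    have "C i \<in> P // equivalence P W"
      using num that unfolding class_numbering_def bij_betw_def by blast
    then show ?thesis using in_quotient_imp_non_empty equiv_equivalence[OF comp] by blast
  qed
  moreover have "X \<in> W \<longleftrightarrow> (\<exists>i. prefix_size Y i < card {x \<in> X. r x \<le> i})" if "X \<subseteq> P" for X
    using Y uniq that by (rule unique_losing_prefix_bounds)
  ultimately show "disjunctive_hierarchical P W"
    using disjunctive_hierarchical_of_prefix_bounds[of m C Y] r C by blast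
qed

end
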